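(* Let $\lambda>0$ and let $T:\mathbb{H}\rightrightarrows V_1$ be an H-monotone set-valued map with $\mathrm{dom}(T)=\mathbb{H}$. (a) If $T$ is maximal H-cyclically monotone, then for every $g\in\mathbb{H}$ the restriction $(\xi_1+\lambda T)|_{H_g}$ is surjective onto $V_1$, i.e. $\bigcup_{g'\in H_g}\{\xi_1(g')+\lambda v:\ v\in T(g')\}=V_1$. (b) Conversely, if for every $g\in\mathbb{H}$ the restriction $(\xi_1+\lambda T)|_{H_g}$ is surjective onto $V_1$, then $T$ is maximal H-monotone.
   Context: The Heisenberg group $\mathbb{H}$ is $\mathbb{R}^3$ with the group law $(x,y,t)\circ(x',y',t')=(x+x',\,y+y',\,t+t'+2(x'y-xy'))$ and unit $e=(0,0,0)$. The first layer $V_1$ of its Lie algebra, spanned by the left-invariant vector fields $X=\partial_x+2y\partial_t$ and $Y=\partial_y-2x\partial_t$, is identified with $\mathbb{R}^2$ (basis $X,Y$) with the Euclidean inner product $\langle\cdot,\cdot\rangle$; for $w=(w_1,w_2)\in V_1$, $\exp w=(w_1,w_2,0)\in\mathbb{H}$. The map $\xi_1:\mathbb{H}\to V_1$ is $\xi_1(x,y,t)=(x,y)$. The horizontal plane through $g_0=(x_0,y_0,t_0)$ is $H_{g_0}=\{g_0\circ\exp w:\ w\in V_1\}=\{(x,y,t):\ t=t_0+2y_0x-2x_0y\}$; one has $g'\in H_g$ iff $g\in H_{g'}$. For a set-valued map $T:\mathbb{H}\rightrightarrows V_1$ (each $T(g)$ is a possibly empty subset of $V_1$), $\mathrm{dom}(T)=\{g\in\mathbb{H}: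 T(g)\neq\emptyset\}$ and $\mathrm{gph}(T)=\{(g,v): g\in\mathrm{dom}(T),\ v\in T(g)\}$. $T$ is H-monotone if $\langle v'-v,\xi_1(g')-\xi_1(g)\rangle\ge 0$ for every $g\in\mathrm{dom}(T)$, $g'\in\mathrm{dom}(T)\cap H_g$, $v\in T(g)$, $v'\in T(g')$. A finite sequence $\{g_i\}_{i=0}^n\subset\mathbb{H}$, $n>0$, is a closed H-sequence if $g_{i+1}\in H_{g_i}$ for $i=0,\dots,n-1$ and $g_n\in H_{g_0}$; in this case one sets $g_{n+1}=g_0$. $T$ is H-cyclically monotone if for every sequence $\{(g_i,v_i)\}_{i=0}^n\subset\mathrm{gph}(T)$ such that $\{g_i\}_{i=0}^n$ is a closed H-sequence, $\sum_{i=0}^n\langle\xi_1(g_{i+1}),v_i\rangle\le\sum_{i=0}^n\langle\xi_1(g_i),v_i\rangle$. An H-monotone (resp. H-cyclically monotone) map $T$ is maximal H-monotone (resp. maximal H-cyclically monotone) if there is no H-monotone (resp. H-cyclically monotone) map $T':\mathbb{H}\rightrightarrows V_1$ with $T(g)\subset T'(g)$ for all $g\in\mathbb{H}$ and $T(g')\subsetneq T'(g')$ for some $g'\in\mathbb{H}$. *)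

theory Defs
  imports "HOL-Analysis.Analysis"
begin

type_synonym heis = "real \<times> real \<times> real"

text \<open>The first layer of the Lie algebra, in coordinates with respect to the basis \<open>X, Y\<close>; its
  inner product \<open>\<bullet>\<close> and norm are those of the product type, i.e. the Euclidean ones. The additive
  structure that the type \<open>heis\<close> carries as a product is not the Heisenberg group law.\<close>

type_synonym layer1 = "real \<times> real"

fun hmult :: "heis \<Rightarrow> heis \<Rightarrow> heis" (infixl "\<odot>" 70) where
  "(x, y, t) \<odot> (x', y', t') = (x + x', y + y', t + t' + 2 * (x' * y - x * y'))"

fun hexp :: "layer1 \<Rightarrow> heis" where
  "hexp (w1, w2) = (w1, w2, 0)"

fun xi1 :: "heis \<Rightarrow> layer1" where
  "xi1 (x, y, t) = (x, y)"

definition hplane :: "heis \<Rightarrow> heis set" where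
  "hplane g0 = {g0 \<odot> hexp w | w. w \<in> UNIV}"

lemma hplane_eq:
  "hplane (x0, y0, t0) = {(x, y, t). t = t0 + 2 * y0 * x - 2 * x0 * y}"
proof (intro set_eqI iffI)
  fix p assume "p \<in> hplane (x0, y0, t0)"
  then show "p \<in> {(x, y, t). t = t0 + 2 * y0 * x - 2 * x0 * y}"
    by (auto simp: hplane_def algebra_simps)
next
  fix p assume "p \<in> {(x, y, t). t = t0 + 2 * y0 * x - 2 * x0 * y}"
  then obtain x y where "p = (x, y, t0 + 2 * y0 * x - 2 * x0 * y)"
    by auto
  then have "p = (x0, y0, t0) \<odot> hexp (x - x0, y - y0)"
    by (simp add: algebra_simps)
  then show "p \<in> hplane (x0, y0, t0)"
    unfolding hplane_def by blast
qed

lemma hplane_sym: "g' \<in> hplane g \<longleftrightarrow> g \<in> hplane g'"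
  by (cases g; cases g') (auto simp: hplane_eq algebra_simps)

text \<open>A set-valued map is a function into sets; its values may be empty.\<close>

definition sv_dom :: "(heis \<Rightarrow> layer1 set) \<Rightarrow> heis set" where
  "sv_dom T = {g. T g \<noteq> {}}"

definition sv_gph :: "(heis \<Rightarrow> layer1 set) \<Rightarrow> (heis \<times> layer1) set" where
  "sv_gph T = {(g, v). g \<in> sv_dom T \<and> v \<in> T g}"

definition H_monotone :: "(heis \<Rightarrow> layer1 set) \<Rightarrow> bool" where
  "H_monotone T \<longleftrightarrow>
    (\<forall>g \<in> sv_dom T. \<forall>g' \<in> sv_dom T \<inter> hplane g. \<forall>v \<in> T g. \<forall>v' \<in> T g'.
      (v' - v) \<bullet> (xi1 g' - xi1 g) \<ge> 0)"

text \<open>A finite sequence \<open>g\<^sub>0, \<dots>, g\<^sub>n\<close> is a function on \<open>nat\<close> of which only the values at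
  \<open>0, \<dots>, n\<close> matter.\<close>

definition closed_H_sequence :: "nat \<Rightarrow> (nat \<Rightarrow> heis) \<Rightarrow> bool" where
  "closed_H_sequence n g \<longleftrightarrow>
    n > 0 \<and> (\<forall>i<n. g (Suc i) \<in> hplane (g i)) \<and> g n \<in> hplane (g 0)"

text \<open>The update \<open>g(Suc n := g 0)\<close> is the convention \<open>g\<^sub>n\<^sub>+\<^sub>1 = g\<^sub>0\<close>.\<close>

definition H_cyclically_monotone :: "(heis \<Rightarrow> layer1 set) \<Rightarrow> bool" where
  "H_cyclically_monotone T \<longleftrightarrow>
    (\<forall>n g v. closed_H_sequence n g \<longrightarrow> (\<forall>i\<le>n. (g i, v i) \<in> sv_gph T) \<longrightarrow>
      (\<Sum>i=0..n. xi1 ((g(Suc n := g 0)) (Suc i)) \<bullet> v i) \<le> (\<Sum>i=0..n. xi1 (g i) \<bullet> v i))"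

definition maximal_H_monotone :: "(heis \<Rightarrow> layer1 set) \<Rightarrow> bool" where
  "maximal_H_monotone T \<longleftrightarrow> H_monotone T \<and>
    \<not> (\<exists>T'. H_monotone T' \<and> (\<forall>g. T g \<subseteq> T' g) \<and> (\<exists>g'. T g' \<subset> T' g'))"

definition maximal_H_cyclically_monotone :: "(heis \<Rightarrow> layer1 set) \<Rightarrow> bool" where
  "maximal_H_cyclically_monotone T \<longleftrightarrow> H_cyclically_monotone T \<and>
    \<not> (\<exists>T'. H_cyclically_monotone T' \<and> (\<forall>g. T g \<subseteq> T' g) \<and> (\<exists>g'. T g' \<subset> T' g'))"

end

theory Submission
  imports Defs
begin

text \<open>Rockafellar's potential \<open>u\<close>, the supremum of the sums along H-chains from a base point, is
  finite because any two points are joined by an H-chain, and maximality forces \<open>T\<close> to be the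
  horizontal subdifferential of \<open>u\<close>. Such a \<open>u\<close> is continuous, so along the plane through \<open>g\<close> the map
  \<open>T\<close> has compact graph over balls and convex values. The restriction of \<open>T\<close> to this plane is not
  monotone, only monotone with respect to the centre \<open>g\<close>; this suffices for coercivity, and
  Brouwer's theorem solves \<open>\<xi>\<^sub>1(g') + \<lambda> v = z\<close>. Conversely, an element \<open>(g, v)\<close> of a monotone
  extension is compared with a solution in the plane through \<open>g\<close> of the equation with right-hand
  side \<open>\<xi>\<^sub>1(g) + \<lambda> v\<close>.\<close>

section \<open>Coordinates for the group law and the horizontal planes\<close>

declare split_paired_All [simp del] split_paired_Ex [simp del]

lemma hmult_hexp:
  "g \<odot> hexp w = (fst g + fst w, fst (snd g) + snd w,
     snd (snd g) + 2 * (fst w * fst (snd g) - fst g * snd w))"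
  by (cases g; cases w) auto

lemma hmult_fst_snd:
  "g \<odot> h = (fst g + fst h, fst (snd g) + fst (snd h),
     snd (snd g) + snd (snd h) + 2 * (fst h * fst (snd g) - fst g * fst (snd h)))"
  by (cases g; cases h) auto

lemma hmult_assoc: "(g \<odot> h) \<odot> k = g \<odot> (h \<odot> k)"
  by (cases g; cases h; cases k) (auto simp: algebra_simps)

lemma xi1_hmult_hexp [simp]: "xi1 (g \<odot> hexp w) = xi1 g + w"
  by (cases g; cases w) auto

lemma hmult_hexp_uminus [simp]: "g \<odot> hexp w \<odot> hexp (- w) = g"
  by (cases g; cases w) (auto simp: algebra_simps)

lemma hplane_iff: "h \<in> hplane g \<longleftrightarrow> (\<exists>w. h = g \<odot> hexp w)"
  by (auto simp: hplane_def)

lemma hplane_iff_xi1: "h \<in> hplane g \<longleftrightarrow> h = g \<odot> hexp (xi1 h - xi1 g)"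
  by (metis add_diff_cancel_left' hplane_iff xi1_hmult_hexp)

lemma hmult_hexp_eq_self_iff: "g \<odot> hexp w = g \<longleftrightarrow> w = 0"
  by (cases g; cases w) (auto simp: zero_prod_def)

lemma continuous_on_hmult [continuous_intros]:
  assumes "continuous_on S f" "continuous_on S g"
  shows "continuous_on S (\<lambda>x. f x \<odot> g x)"
  unfolding hmult_fst_snd by (intro continuous_intros assms)

lemma continuous_on_hexp [continuous_intros]:
  assumes "continuous_on S f"
  shows "continuous_on S (\<lambda>x. hexp (f x))"
proof -
  have "hexp w = (fst w, snd w, 0)" for w by (cases w) auto
  then show ?thesis by (simp add: assms continuous_intros)
qed

section \<open>Zeros of set-valued maps\<close>

text \<open>If \<open>0\<close> is never a value, separating hyperplanes glue to a continuous field \<open>p\<close> that is positive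
  on all values; Brouwer's theorem applied to \<open>- r p / |p|\<close> contradicts the boundary condition.\<close>

lemma set_valued_zero_exists:
  fixes F :: "'a::euclidean_space \<Rightarrow> 'a set"
  assumes r: "r > 0"
    and compact_graph: "compact {(x, y). x \<in> cball 0 r \<and> y \<in> F x}"
    and conv: "\<And>x. x \<in> cball 0 r \<Longrightarrow> convex (F x)"
    and bdry: "\<And>x y. norm x = r \<Longrightarrow> y \<in> F x \<Longrightarrow> 0 \<le> x \<bullet> y"
    and ne: "\<And>x. x \<in> cball 0 r \<Longrightarrow> F x \<noteq> {}"
  shows "\<exists>x\<in>cball 0 r. 0 \<in> F x"
proof (rule ccontr)
  assume no_zero: "\<not> ?thesis"
  define G where "G = {(x, y). x \<in> cball 0 r \<and> y \<in> F x}"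
  \<comment> \<open>The extra point \<open>z\<close> keeps every \<open>K a\<close> nonempty,
    because \<open>infdist\<close> to the empty set is 0.\<close>
  obtain z :: 'a where z: "z \<notin> cball 0 r"
    by (metis bounded_cball not_bounded_UNIV subsetI subset_antisym top_greatest)
  \<comment> \<open>At a point of the ball outside \<open>K a\<close>, the vector \<open>a\<close>
    is strictly positive on all values of \<open>F\<close>.\<close>
  define K where "K a = insert z (fst ` (G \<inter> {q. a \<bullet> snd q \<le> 0}))" for a
  have closedK: "closed (K a)" for a
  proof -
    have "closed {q :: 'a \<times> 'a. a \<bullet> snd q \<le> 0}"
      by (intro closed_Collect_le continuous_intros)
    then have "compact (G \<inter> {q. a \<bullet> snd q \<le> 0})"
      using compact_graph unfolding G_def by (rule compact_Int_closed[rotated])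
    then have "compact (fst ` (G \<inter> {q. a \<bullet> snd q \<le> 0}))"
      by (intro compact_continuous_image continuous_intros)
    then show ?thesis
      unfolding K_def by (intro compact_imp_closed compact_insert)
  qed
  have K_pos: "0 < a \<bullet> y" if "x \<in> cball 0 r" "y \<in> F x" "x \<notin> K a" for a x y
    using that by (force simp: K_def G_def image_iff)
  have separated: "\<exists>a. x \<notin> K a" if x: "x \<in> cball 0 r" for x
  proof -
    have "F x = snd ` (G \<inter> {q. fst q = x})"
      using x by (force simp: G_def image_iff)
    moreover have "compact (snd ` (G \<inter> {q. fst q = x}))"
      using compact_graph unfolding G_def
      by (intro compact_continuous_image continuous_intros compact_Int_closed
          closed_Collect_eq) auto
    ultimately have "closed (F x)" by (simp add: compact_imp_closed)
    moreover have "0 \<notin> F x" using no_zero x by blast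
    ultimately obtain a b where "0 < b" "\<And>y. y \<in> F x \<Longrightarrow> b < a \<bullet> y"
      using separating_hyperplane_closed_0 conv[OF x] by metis
    then have "\<And>y. y \<in> F x \<Longrightarrow> 0 < a \<bullet> y" using order.strict_trans by blast
    moreover have "x \<noteq> z" using x z by blast
    ultimately have "x \<notin> K a" by (force simp: K_def G_def)
    then show ?thesis by blast
  qed
  have "cball 0 r \<subseteq> (\<Union>a\<in>UNIV. - K a)" using separated by blast
  then obtain A where A: "finite A" "cball 0 r \<subseteq> (\<Union>a\<in>A. - K a)"
    using compactE_image[OF compact_cball, of UNIV "\<lambda>a. - K a" 0 r] closedK
    by (metis open_Compl)
  \<comment> \<open>An unnormalised partition of unity: the weights are continuous and vanish
    exactly on \<open>K a\<close>, so only vectors positive on \<open>F x\<close> contribute at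
    \<open>x\<close>.\<close>
  define p where "p x = (\<Sum>a\<in>A. infdist x (K a) *\<^sub>R a)" for x
  have p_pos: "0 < p x \<bullet> y" if x: "x \<in> cball 0 r" and y: "y \<in> F x" for x y
  proof -
    have K_ne: "K a \<noteq> {}" for a by (simp add: K_def)
    obtain b where b: "b \<in> A" "x \<notin> K b" using A(2) x by blast
    have "0 < infdist x (K b) * (b \<bullet> y)"
      using K_pos[OF x y b(2)] infdist_pos_not_in_closed[OF closedK K_ne b(2)] by simp
    moreover have "0 \<le> infdist x (K a) * (a \<bullet> y)" for a
      using K_pos[OF x y, of a] by (cases "x \<in> K a") (auto intro: mult_nonneg_nonneg infdist_nonneg)
    ultimately have "0 < (\<Sum>a\<in>A. infdist x (K a) * (a \<bullet> y))"
      using A(1) b(1) by (meson sum_pos2)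
    then show ?thesis by (simp add: p_def inner_sum_left)
  qed
  have p_nz: "p x \<noteq> 0" if "x \<in> cball 0 r" for x
    using p_pos[OF that] ne[OF that] by fastforce
  define f where "f x = - (r / norm (p x)) *\<^sub>R p x" for x
  have "continuous_on (cball 0 r) f"
    unfolding f_def p_def
    using p_nz unfolding p_def by (intro continuous_intros) auto
  moreover have norm_f: "norm (f x) = r" if "x \<in> cball 0 r" for x
    using p_nz[OF that] r by (simp add: f_def)
  ultimately obtain x where x: "x \<in> cball 0 r" "f x = x"
    using brouwer[of "cball 0 r" f] r by force
  obtain y where y: "y \<in> F x" using ne x(1) by blast
  have "x \<bullet> y = - (r / norm (p x)) * (p x \<bullet> y)"
    by (metis f_def inner_scaleR_left x(2))
  moreover have "0 < (r / norm (p x)) * (p x \<bullet> y)"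
    using p_pos[OF x(1) y] p_nz[OF x(1)] r by simp
  ultimately show False
    using bdry[OF _ y] norm_f[OF x(1)] x(2) by simp
qed

section \<open>Continuity of H-subdifferentiable functions\<close>

text \<open>The horizontal subdifferential: the points \<open>g \<odot> hexp w\<close> run exactly
  through the horizontal plane of \<open>g\<close>.\<close>

definition H_subdiff :: "(heis \<Rightarrow> real) \<Rightarrow> heis \<Rightarrow> layer1 set" where
  "H_subdiff u g = {v. \<forall>w. u g + v \<bullet> w \<le> u (g \<odot> hexp w)}"

lemma H_subdiffD: "v \<in> H_subdiff u g \<Longrightarrow> u g + v \<bullet> w \<le> u (g \<odot> hexp w)"
  by (auto simp: H_subdiff_def)

lemma convex_H_subdiff: "convex (H_subdiff u g)"
proof -
  have "H_subdiff u g = (\<Inter>w. {v. w \<bullet> v \<le> u (g \<odot> hexp w) - u g})"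
    by (simp add: H_subdiff_def inner_commute set_eq_iff le_diff_eq add.commute)
  then show ?thesis by (auto intro: convex_INT convex_halfspace_le)
qed

text \<open>Increments act on the right, so left translations leave subgradients unchanged. This
  reduces continuity everywhere to continuity at the unit.\<close>

lemma H_subdiff_translate: "H_subdiff (\<lambda>g. u (h \<odot> g)) g = H_subdiff u (h \<odot> g)"
  by (simp add: H_subdiff_def hmult_assoc)

text \<open>A subgradient at \<open>g\<close> cannot be negative on both \<open>w\<close> and
  \<open>w'\<close>, since a nontrivial nonnegative combination of them vanishes; hence
  \<open>u\<close> is at least \<open>u g\<close> at one of the two points. A zero weight is allowed
  so that endpoints of segments are covered.\<close>

lemma H_subdiff_quasiconvex:
  assumes "H_subdiff u g \<noteq> {}" "0 \<le> a" "0 \<le> b" "0 < a + b" "a *\<^sub>R w + b *\<^sub>R w' = 0"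
    "u (g \<odot> hexp w) \<le> M" "u (g \<odot> hexp w') \<le> M"
  shows "u g \<le> M"
proof -
  obtain v where v: "v \<in> H_subdiff u g" using assms(1) by blast
  have "a * (v \<bullet> w) + b * (v \<bullet> w') = v \<bullet> (a *\<^sub>R w + b *\<^sub>R w')"
    by (simp add: inner_add_right)
  then have eq: "a * (v \<bullet> w) + b * (v \<bullet> w') = 0" using assms(5) by simp
  have "0 \<le> v \<bullet> w \<or> 0 \<le> v \<bullet> w'"
  proof (rule ccontr)
    assume "\<not> ?thesis"
    then have neg: "v \<bullet> w < 0" "v \<bullet> w' < 0" by auto
    show False
    proof (cases "a = 0")
      case True
      then show False using eq neg assms by auto
    next
      case False
      then have "a * (v \<bullet> w) < 0" using neg assms by (simp add: mult_pos_neg)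
      moreover have "b * (v \<bullet> w') \<le> 0" using neg assms by (simp add: mult_nonneg_nonpos)
      ultimately show False using eq by simp
    qed
  qed
  then show ?thesis
    using H_subdiffD[OF v, of w] H_subdiffD[OF v, of w'] assms(6,7) by linarith
qed

text \<open>The horizontal segments from \<open>(s, 0, 1)\<close> to \<open>(0, 1/s, -1)\<close> sweep out the quadric
  \<open>4 x y + t\<^sup>2 = 1\<close>, and a horizontal line in direction \<open>(1, 1)\<close> through a point near the unit
  meets both sheets of it. So near the unit, \<open>u\<close> is bounded by its values at four points.\<close>

lemma H_subdiff_bounded_above:
  assumes sub: "\<And>g. H_subdiff u g \<noteq> {}"
  obtains M where "\<And>x y t. \<bar>x\<bar> \<le> 1/10 \<Longrightarrow> \<bar>y\<bar> \<le> 1/10 \<Longrightarrow> \<bar>t\<bar> \<le> 1/10 \<Longrightarrow> u (x, y, t) \<le> M"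
proof
  \<comment> \<open>These four points end two horizontal segments. Length 5 is enough:
    \<open>2 * x / (1 + t)\<close> is at most 4.4 in absolute value for \<bar>x\<bar> \<le> 11/10
    and \<bar>t\<bar> \<le> 1/2, and likewise for \<open>y\<close>.\<close>
  define M where "M = Max {u (5, 0, 1), u (-5, 0, 1), u (0, 5, -1), u (0, -5, -1)}"
  have M: "u (5, 0, 1) \<le> M" "u (-5, 0, 1) \<le> M" "u (0, 5, -1) \<le> M" "u (0, -5, -1) \<le> M"
    by (simp_all add: M_def)
  have line1: "u (s, 0, 1) \<le> M" if "\<bar>s\<bar> \<le> 5" for s
    by (rule H_subdiff_quasiconvex[OF sub, of "5 + s" "5 - s" "(5 - s, 0)" "(- 5 - s, 0)"])
      (use M that in \<open>simp_all add: zero_prod_def algebra_simps\<close>)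
  have line2: "u (0, s, -1) \<le> M" if "\<bar>s\<bar> \<le> 5" for s
    by (rule H_subdiff_quasiconvex[OF sub, of "5 + s" "5 - s" "(0, 5 - s)" "(0, - 5 - s)"])
      (use M that in \<open>simp_all add: zero_prod_def algebra_simps\<close>)
  have quadric: "u (x, y, t) \<le> M"
    if eq: "4 * x * y + t\<^sup>2 = 1" and b: "\<bar>x\<bar> \<le> 11/10" "\<bar>y\<bar> \<le> 11/10" "\<bar>t\<bar> \<le> 1/2" for x y t
  proof -
    \<comment> \<open>The point \<open>(x, y, t)\<close> divides the segment from
      \<open>(s, 0, 1)\<close> to \<open>(0, r, -1)\<close> with weights \<open>(1 + t) / 2\<close>
      and \<open>(1 - t) / 2\<close>; the equation of the quadric gives \<open>s * r = 1\<close>,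
      which makes the segment horizontal.\<close>
    define s where "s = 2 * x / (1 + t)"
    define r where "r = 2 * y / (1 - t)"
    have tp: "0 < 1 + t" "0 < 1 - t" using b by auto
    have s: "s * (1 + t) = 2 * x" and r: "r * (1 - t) = 2 * y"
      using tp by (simp_all add: s_def r_def)
    have "\<bar>s\<bar> * (1 + t) = 2 * \<bar>x\<bar>" "\<bar>r\<bar> * (1 - t) = 2 * \<bar>y\<bar>"
      using tp by (simp_all add: s_def r_def abs_mult)
    moreover have "5 * (1 + t) \<ge> 5/2" "5 * (1 - t) \<ge> 5/2" using b by auto
    ultimately have "\<bar>s\<bar> * (1 + t) \<le> 5 * (1 + t)" "\<bar>r\<bar> * (1 - t) \<le> 5 * (1 - t)"
      using b by linarith+
    then have sr: "\<bar>s\<bar> \<le> 5" "\<bar>r\<bar> \<le> 5" using tp by (simp_all only: mult_le_cancel_right_pos)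
    have "(2 * s * y) * (1 + t) = (1 - t) * (1 + t)" "(2 * x * r) * (1 - t) = (1 + t) * (1 - t)"
      using s r eq by (algebra)+
    then have sy: "2 * s * y = 1 - t" and xr: "2 * x * r = 1 + t"
      using tp by simp_all
    have e1: "(x, y, t) \<odot> hexp (s - x, - y) = (s, 0, 1)"
      using sy by (simp add: algebra_simps)
    have e2: "(x, y, t) \<odot> hexp (- x, r - y) = (0, r, -1)"
      using xr by (simp add: algebra_simps)
    have "(1 + t) *\<^sub>R (s - x, - y) + (1 - t) *\<^sub>R (- x, r - y) = 0"
      using s r by (simp add: zero_prod_def algebra_simps)
    then show ?thesis
      by (rule H_subdiff_quasiconvex[OF sub, rotated 3])
        (use tp line1[OF sr(1)] line2[OF sr(2)] in \<open>simp_all add: e1 e2 del: hmult.simps hexp.simps\<close>)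
  qed
  fix x y t :: real
  assume b: "\<bar>x\<bar> \<le> 1/10" "\<bar>y\<bar> \<le> 1/10" "\<bar>t\<bar> \<le> 1/10"
  \<comment> \<open>The polynomial of the quadric evaluated at
    \<open>(x, y, t) \<odot> hexp (\<sigma>, \<sigma>)\<close>. It is at most 1 at 0 and at least 1
    at both 1 and -1, so the line meets the quadric on either side.\<close>
  define q where "q \<sigma> = 4 * (x + \<sigma>) * (y + \<sigma>) + (t + 2 * (\<sigma> * y - x * \<sigma>))\<^sup>2" for \<sigma>
  have cont: "continuous_on S q" for S
    unfolding q_def by (intro continuous_intros)
  have "\<bar>x * y\<bar> \<le> 1/10 * (1/10)" unfolding abs_mult using b by (intro mult_mono) auto
  moreover have "t\<^sup>2 \<le> (1/10)\<^sup>2" using b by (intro abs_le_square_iff[THEN iffD1]) auto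
  ultimately have q0: "q 0 \<le> 1" by (simp add: q_def power2_eq_square)
  have "9/10 * (9/10) \<le> (x + 1) * (y + 1)" using b by (intro mult_mono) auto
  moreover have "q 1 = 4 * ((x + 1) * (y + 1)) + (t + 2 * (y - x))\<^sup>2"
    by (simp add: q_def mult.assoc)
  ultimately have q1: "1 \<le> q 1"
    using zero_le_power2[of "t + 2 * (y - x)"] by linarith
  have "9/10 * (9/10) \<le> (1 - x) * (1 - y)" using b by (intro mult_mono) auto
  moreover have "q (-1) = 4 * ((1 - x) * (1 - y)) + (t + 2 * (x - y))\<^sup>2"
    by (simp add: q_def algebra_simps)
  ultimately have q2: "1 \<le> q (-1)"
    using zero_le_power2[of "t + 2 * (x - y)"] by linarith
  obtain \<sigma> where \<sigma>: "0 \<le> \<sigma>" "\<sigma> \<le> 1" "q \<sigma> = 1" using IVT'[OF q0 q1 _ cont] by auto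
  obtain \<rho> where \<rho>: "-1 \<le> \<rho>" "\<rho> \<le> 0" "q \<rho> = 1" using IVT2'[OF q0 q2 _ cont] by auto
  have on_quadric: "u ((x, y, t) \<odot> hexp (\<tau>, \<tau>)) \<le> M" if \<tau>: "\<bar>\<tau>\<bar> \<le> 1" "q \<tau> = 1" for \<tau>
  proof -
    have "\<bar>y - x\<bar> \<le> 1/5" using b by linarith
    then have "\<bar>\<tau> * (y - x)\<bar> \<le> 1 * (1/5)" unfolding abs_mult using \<tau>(1) by (intro mult_mono) auto
    then have "\<bar>t + 2 * (\<tau> * (y - x))\<bar> \<le> 1/2" using b(3) unfolding abs_le_iff by linarith
    moreover have "\<tau> * (y - x) = \<tau> * y - x * \<tau>" by (simp add: algebra_simps)
    ultimately have "\<bar>t + 2 * (\<tau> * y - x * \<tau>)\<bar> \<le> 1/2" by (simp only:)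
    moreover have "\<bar>x + \<tau>\<bar> \<le> 11/10" "\<bar>y + \<tau>\<bar> \<le> 11/10" using \<tau>(1) b by linarith+
    ultimately show ?thesis using \<tau>(2) by (simp add: quadric q_def)
  qed
  \<comment> \<open>Here \<open>q 0 < 1\<close> strictly, so the weights \<open>- \<rho>\<close> and
    \<open>\<sigma>\<close> used below have a positive sum.\<close>
  have ne: "\<sigma> \<noteq> 0"
  proof
    assume "\<sigma> = 0"
    then show False using \<sigma>(3) \<open>\<bar>x * y\<bar> \<le> _\<close> \<open>t\<^sup>2 \<le> _\<close> by (simp add: q_def power2_eq_square)
  qed
  show "u (x, y, t) \<le> M"
    by (rule H_subdiff_quasiconvex[OF sub, of "- \<rho>" \<sigma> "(\<sigma>, \<sigma>)" "(\<rho>, \<rho>)"])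
      (use on_quadric[of \<sigma>] on_quadric[of \<rho>] \<sigma> \<rho> ne in
        \<open>simp_all add: zero_prod_def algebra_simps\<close>)
qed

text \<open>Convexity along horizontal lines gives \<open>M - u (h \<odot> hexp w) \<le> (1 + 20 |w|) (M - u h)\<close> near the
  unit. Five short horizontal segments connect the unit to any nearby point, in both directions.\<close>

lemma H_subdiff_continuous_at_unit:
  assumes sub: "\<And>g. H_subdiff u g \<noteq> {}"
  shows "isCont u (0, 0, 0)"
proof -
  obtain M where M: "\<And>x y t. \<bar>x\<bar> \<le> 1/10 \<Longrightarrow> \<bar>y\<bar> \<le> 1/10 \<Longrightarrow> \<bar>t\<bar> \<le> 1/10 \<Longrightarrow> u (x, y, t) \<le> M"
    by (rule H_subdiff_bounded_above[OF sub]) blast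
  \<comment> \<open>Half the width of the box where \<open>M\<close> bounds \<open>u\<close>: a
    horizontal step of length 1/20 from \<open>B\<close> stays in that larger box.\<close>
  define B :: "heis set" where "B = {-1/20..1/20} \<times> {-1/20..1/20} \<times> {-1/20..1/20}"
  define D where "D g = M - u g" for g
  have D_nonneg: "0 \<le> D h" if "h \<in> B" for h
    using that by (cases h) (auto simp: B_def D_def intro!: M)
  have D_step: "D (h \<odot> hexp w) \<le> (1 + 20 * \<rho>) * D h" if h: "h \<in> B" and w: "norm w \<le> \<rho>" for h w \<rho>
  proof -
    have "D (h \<odot> hexp w) \<le> (1 + 20 * norm w) * D h"
    proof (cases "w = 0")
      case True
      then show ?thesis by (simp add: hmult_hexp_eq_self_iff[THEN iffD2])
    next
      case False
      \<comment> \<open>A step of length 1/20 against \<open>w\<close>. The bound \<open>M\<close>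
        at its end controls \<open>- (v \<bullet> w)\<close>, and the subgradient inequality at
        \<open>w\<close> then controls \<open>D (h \<odot> hexp w)\<close>.\<close>
      define e where "e = - (1 / (20 * norm w)) *\<^sub>R w"
      obtain v where v: "v \<in> H_subdiff u h" using sub by blast
      have "norm e = 1/20" using False by (simp add: e_def)
      then have e: "\<bar>fst e\<bar> \<le> 1/20" "\<bar>snd e\<bar> \<le> 1/20"
        using norm_fst_le[of "fst e" "snd e"] norm_snd_le[of "snd e" "fst e"] by auto
      obtain x y t where xyt: "h = (x, y, t)" by (cases h)
      have b: "\<bar>x\<bar> \<le> 1/20" "\<bar>y\<bar> \<le> 1/20" "\<bar>t\<bar> \<le> 1/20" using h by (auto simp: B_def xyt)
      have prods: "\<bar>fst e * y\<bar> \<le> 1/20 * (1/20)" "\<bar>x * snd e\<bar> \<le> 1/20 * (1/20)"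
        unfolding abs_mult using e b by (intro mult_mono; simp)+
      have "\<bar>t + 2 * (fst e * y - x * snd e)\<bar> \<le> 1/10"
        using prods b(3) by argo
      moreover have "\<bar>x + fst e\<bar> \<le> 1/10" "\<bar>y + snd e\<bar> \<le> 1/10"
        using e b by linarith+
      ultimately have "u (h \<odot> hexp e) \<le> M"
        unfolding hmult_hexp xyt fst_conv snd_conv by (intro M)
      moreover have "u h + v \<bullet> e \<le> u (h \<odot> hexp e)" by (rule H_subdiffD[OF v])
      moreover have "v \<bullet> e = - (v \<bullet> w) / (20 * norm w)" by (simp add: e_def)
      ultimately have "- (v \<bullet> w) / (20 * norm w) \<le> D h" by (simp add: D_def)
      then have "- (v \<bullet> w) \<le> 20 * norm w * D h"
        using pos_divide_le_eq[of "20 * norm w" "- (v \<bullet> w)" "D h"] False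
        by (metis mult.commute mult_pos_pos zero_less_norm_iff zero_less_numeral)
      moreover have "u h + v \<bullet> w \<le> u (h \<odot> hexp w)" by (rule H_subdiffD[OF v])
      ultimately show ?thesis by (simp add: D_def algebra_simps)
    qed
    also have "\<dots> \<le> (1 + 20 * \<rho>) * D h" using w D_nonneg[OF h] by (intro mult_right_mono) auto
    finally show ?thesis .
  qed
  have D_step2: "D h' \<le> (1 + 20 * \<rho>) * D h \<and> D h \<le> (1 + 20 * \<rho>) * D h'"
    if "h \<in> B" "h' \<in> B" "norm w \<le> \<rho>" "h' = h \<odot> hexp w" for h h' w \<rho>
    using D_step[of h w \<rho>] D_step[of h' "- w" \<rho>] that by simp
  \<comment> \<open>A homogeneous gauge: a vertical displacement \<open>t\<close> costs horizontal
    steps of length of order \<open>sqrt \<bar>t\<bar>\<close>.\<close>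
  define \<rho> where "\<rho> g = sqrt \<bar>snd (snd g)\<bar> + norm (fst g, fst (snd g))" for g :: heis
  define P where "P g = (1 + 20 * \<rho> g) ^ 5" for g
  have compare: "D g \<le> P g * D (0, 0, 0) \<and> D (0, 0, 0) \<le> P g * D g" if small: "\<rho> g \<le> 1/20" for g
  proof -
    obtain x y t where g: "g = (x, y, t)" by (cases g)
    define k where "k = 1 + 20 * \<rho> g"
    \<comment> \<open>Following a rectangle with sides \<open>a\<close> and \<open>b\<close>
      horizontally lifts the endpoint by \<open>- 4 * a * b\<close>. The sign of \<open>b\<close> is
      chosen so that the lift is \<open>t\<close>; a fifth step \<open>(x, y)\<close> then reaches
      \<open>g\<close>.\<close>
    define a where "a = sqrt \<bar>t\<bar> / 2"
    define b where "b = - sgn t * a"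
    have a: "0 \<le> a" "\<bar>b\<bar> \<le> a" by (auto simp: a_def b_def abs_mult sgn_real_def)
    have aa: "a * a = \<bar>t\<bar> / 4" by (simp add: a_def)
    then have ab: "4 * (a * b) = - t" by (auto simp: b_def algebra_simps sgn_real_def)
    have n: "norm (x, y) \<le> \<rho> g" "2 * a \<le> \<rho> g" by (auto simp: \<rho>_def g a_def)
    then have ar: "a \<le> \<rho> g" "\<bar>b\<bar> \<le> \<rho> g" using a by linarith+
    have xy: "\<bar>x\<bar> \<le> 1/20" "\<bar>y\<bar> \<le> 1/20"
      using norm_fst_le[of x y] norm_snd_le[of y x] n small by auto
    have a20: "a \<le> 1/20" "\<bar>b\<bar> \<le> 1/20" using ar small by auto
    have "2 * a * (2 * a) \<le> 1/20 * (1/20)" using a n small by (intro mult_mono) auto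
    then have t: "\<bar>t\<bar> \<le> 1/20" using aa by simp
    have B: "(0, 0, 0) \<in> B" "(a, 0, 0) \<in> B" "(a, b, t / 2) \<in> B" "(0, b, t) \<in> B" "(0, 0, t) \<in> B" "g \<in> B"
      using a a20 xy t unfolding B_def g by auto
    have "0 \<le> k" using a n by (simp add: k_def)
    have near: "D p \<le> k * D q \<and> D q \<le> k * D p"
      if "q \<in> B" "p \<in> B" "norm w \<le> \<rho> g" "p = q \<odot> hexp w" for p q w
      unfolding k_def using that by (rule D_step2)
    have s1: "D (a, 0, 0) \<le> k * D (0, 0, 0) \<and> D (0, 0, 0) \<le> k * D (a, 0, 0)"
      using B a ar by (intro near[where w = "(a, 0)"]) auto
    have s2: "D (a, b, t / 2) \<le> k * D (a, 0, 0) \<and> D (a, 0, 0) \<le> k * D (a, b, t / 2)"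
      using B ar ab by (intro near[where w = "(0, b)"]) auto
    have s3: "D (0, b, t) \<le> k * D (a, b, t / 2) \<and> D (a, b, t / 2) \<le> k * D (0, b, t)"
      using B a ar ab by (intro near[where w = "(- a, 0)"]) auto
    have s4: "D (0, 0, t) \<le> k * D (0, b, t) \<and> D (0, b, t) \<le> k * D (0, 0, t)"
      using B ar by (intro near[where w = "(0, - b)"]) auto
    have s5: "D g \<le> k * D (0, 0, t) \<and> D (0, 0, t) \<le> k * D g"
      using B n g by (intro near[where w = "(x, y)"]) auto
    have chain: "d5 \<le> k ^ 5 * d0"
      if "d1 \<le> k * d0" "d2 \<le> k * d1" "d3 \<le> k * d2" "d4 \<le> k * d3" "d5 \<le> k * d4"
      for d0 d1 d2 d3 d4 d5
    proof -
      have "d2 \<le> k * (k * d0)" using that \<open>0 \<le> k\<close> by (meson mult_left_mono order_trans)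
      then have "d3 \<le> k * (k * (k * d0))" using that \<open>0 \<le> k\<close> by (meson mult_left_mono order_trans)
      then have "d4 \<le> k * (k * (k * (k * d0)))"
        using that \<open>0 \<le> k\<close> by (meson mult_left_mono order_trans)
      then have "d5 \<le> k * (k * (k * (k * (k * d0))))"
        using that \<open>0 \<le> k\<close> by (meson mult_left_mono order_trans)
      then show ?thesis by (simp add: eval_nat_numeral mult.assoc)
    qed
    show ?thesis
      unfolding P_def k_def[symmetric] using s1 s2 s3 s4 s5 by (auto intro: chain)
  qed
  have P_pos: "0 < P g" for g
    unfolding P_def \<rho>_def by (intro zero_less_power add_pos_nonneg) auto
  have cont_\<rho>: "isCont \<rho> (0, 0, 0)"
    unfolding \<rho>_def by (intro continuous_intros)
  have \<rho>0: "\<rho> (0, 0, 0) = 0" by (simp add: \<rho>_def norm_prod_def)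
  then have "eventually (\<lambda>g. \<rho> g < 1/20) (at (0, 0, 0))"
    using order_tendstoD(2)[OF cont_\<rho>[unfolded isCont_def], of "1/20"] by simp
  then have "eventually (\<lambda>g. \<rho> g \<le> 1/20) (at (0, 0, 0))"
    by (rule eventually_mono) simp
  then have ev: "eventually (\<lambda>g. D g \<le> P g * D (0, 0, 0) \<and> D (0, 0, 0) / P g \<le> D g) (at (0, 0, 0))"
    by (rule eventually_mono) (use compare P_pos in \<open>simp add: pos_divide_le_eq mult.commute\<close>)
  have "(P \<longlongrightarrow> (1 + 20 * \<rho> (0, 0, 0)) ^ 5) (at (0, 0, 0))"
    unfolding P_def by (intro tendsto_intros cont_\<rho>[unfolded isCont_def])
  then have P1: "(P \<longlongrightarrow> 1) (at (0, 0, 0))" by (simp add: \<rho>0)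
  have "((\<lambda>g. P g * D (0, 0, 0)) \<longlongrightarrow> 1 * D (0, 0, 0)) (at (0, 0, 0))"
    "((\<lambda>g. D (0, 0, 0) / P g) \<longlongrightarrow> D (0, 0, 0) / 1) (at (0, 0, 0))"
    by (intro tendsto_intros P1; simp)+
  then have "(D \<longlongrightarrow> D (0, 0, 0)) (at (0, 0, 0))"
    using tendsto_sandwich[of "\<lambda>g. D (0, 0, 0) / P g" D _ "\<lambda>g. P g * D (0, 0, 0)"]
      ev[unfolded eventually_conj_iff] by simp
  then have "((\<lambda>g. M - D g) \<longlongrightarrow> M - D (0, 0, 0)) (at (0, 0, 0))"
    by (intro tendsto_intros)
  then show ?thesis by (simp add: D_def isCont_def)
qed

lemma H_subdiff_continuous:
  assumes sub: "\<And>g. H_subdiff u g \<noteq> {}"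
  shows "continuous_on UNIV u"
proof -
  have "isCont u h" for h
  proof -
    obtain x y t where h: "h = (x, y, t)" by (cases h)
    define k where "k = (- x, - y, - t)"
    have "isCont (\<lambda>g. u (h \<odot> g)) (0, 0, 0)"
      by (rule H_subdiff_continuous_at_unit) (simp add: H_subdiff_translate sub)
    moreover have "k \<odot> h = (0, 0, 0)" by (simp add: h k_def)
    moreover have "isCont ((\<odot>) k) h"
    proof -
      have "continuous_on UNIV ((\<odot>) k)" by (intro continuous_intros)
      then show ?thesis by (simp add: continuous_on_eq_continuous_at)
    qed
    ultimately have "isCont (\<lambda>g. u (h \<odot> (k \<odot> g))) h"
      using isCont_o2[of h "(\<odot>) k" "\<lambda>g. u (h \<odot> g)"] by simp
    moreover have "h \<odot> (k \<odot> g) = g" for g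
      by (cases g) (simp add: h k_def algebra_simps)
    ultimately show ?thesis by simp
  qed
  then show ?thesis by (simp add: continuous_at_imp_continuous_on)
qed

text \<open>Continuity of \<open>u\<close> makes each defining inequality a closed condition, and
  bounds on \<open>u\<close> near the compact set of base points bound the subgradients.\<close>

lemma compact_H_subdiff_graph:
  assumes cont: "continuous_on UNIV u"
  shows "compact {(w, v). w \<in> cball 0 r \<and> v \<in> H_subdiff u (g \<odot> hexp w)}" (is "compact ?G")
proof -
  note cont' = continuous_on_compose2[OF cont _ subset_UNIV]
  define K where "K = (\<lambda>(w, w'). u (g \<odot> hexp w \<odot> hexp w')) ` (cball 0 r \<times> cball 0 1)"
  have "compact K"
    unfolding K_def split_def
    by (intro compact_continuous_image compact_Times compact_cball cont' continuous_intros)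
  then obtain M where M: "\<And>k. k \<in> K \<Longrightarrow> \<bar>k\<bar> \<le> M"
    using compact_imp_bounded bounded_iff by (metis real_norm_def)
  have bd: "norm v \<le> 2 * M" if w: "w \<in> cball 0 r" and v: "v \<in> H_subdiff u (g \<odot> hexp w)" for w v
  proof -
    \<comment> \<open>Testing \<open>v\<close> in its own direction bounds \<open>norm v\<close> by
      a difference of two values of \<open>u\<close> in \<open>K\<close>.\<close>
    have "v \<bullet> sgn v = norm v"
      by (cases "v = 0") (simp_all add: sgn_div_norm dot_square_norm power2_eq_square)
    then have "u (g \<odot> hexp w) + norm v \<le> u (g \<odot> hexp w \<odot> hexp (sgn v))"
      using H_subdiffD[OF v, of "sgn v"] by simp
    moreover have "\<bar>u (g \<odot> hexp w \<odot> hexp (sgn v))\<bar> \<le> M"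
      using w by (intro M) (force simp: K_def norm_sgn)
    moreover have "g \<odot> hexp w \<odot> hexp 0 = g \<odot> hexp w" by (simp add: hmult_hexp_eq_self_iff)
    then have "\<bar>u (g \<odot> hexp w)\<bar> \<le> M"
      using w by (intro M) (force simp: K_def intro!: rev_image_eqI[of "(w, 0)"])
    ultimately show ?thesis by linarith
  qed
  have "?G \<subseteq> cball 0 r \<times> cball 0 (2 * M)" using bd by auto
  then have "bounded ?G" by (rule bounded_subset[rotated]) (intro bounded_Times bounded_cball)
  moreover have "?G = (cball 0 r \<times> UNIV) \<inter>
      (\<Inter>w'. {q. u (g \<odot> hexp (fst q)) + snd q \<bullet> w' \<le> u (g \<odot> hexp (fst q) \<odot> hexp w')})"
    by (simp add: H_subdiff_def set_eq_iff mem_Times_iff case_prod_unfold)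
  moreover have "closed \<dots>"
    by (intro closed_Int closed_Times closed_INT ballI closed_Collect_le continuous_intros cont') auto
  ultimately show ?thesis by (simp add: compact_eq_bounded_closed)
qed

section \<open>The potential of an H-cyclically monotone map\<close>

text \<open>The subgradient inequalities telescope to 0 around a closed sequence. This makes the
  subdifferential of the potential a competitor in the maximality of \<open>T\<close>.\<close>

lemma H_cyclically_monotone_subdiff: "H_cyclically_monotone (H_subdiff u)"
  unfolding H_cyclically_monotone_def
proof (intro allI impI)
  fix n g v
  assume seq: "closed_H_sequence n g" and gph: "\<forall>i\<le>n. (g i, v i) \<in> sv_gph (H_subdiff u)"
  define \<gamma> where "\<gamma> = g(Suc n := g 0)"
  have "xi1 (\<gamma> (Suc i)) \<bullet> v i - xi1 (g i) \<bullet> v i \<le> u (\<gamma> (Suc i)) - u (\<gamma> i)" if i: "i \<le> n" for i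
  proof -
    have "\<gamma> (Suc i) \<in> hplane (\<gamma> i)"
      using seq i hplane_sym by (cases "i = n") (auto simp: closed_H_sequence_def \<gamma>_def)
    then have "\<gamma> (Suc i) = g i \<odot> hexp (xi1 (\<gamma> (Suc i)) - xi1 (g i))"
      using i by (simp add: hplane_iff_xi1 \<gamma>_def)
    moreover have "v i \<in> H_subdiff u (g i)" using gph i by (simp add: sv_gph_def)
    ultimately have "u (g i) + v i \<bullet> (xi1 (\<gamma> (Suc i)) - xi1 (g i)) \<le> u (\<gamma> (Suc i))"
      using H_subdiffD by metis
    then show ?thesis using i by (simp add: \<gamma>_def inner_diff_right inner_commute)
  qed
  then have "(\<Sum>i=0..n. xi1 (\<gamma> (Suc i)) \<bullet> v i - xi1 (g i) \<bullet> v i) \<le>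
      (\<Sum>i=0..n. u (\<gamma> (Suc i)) - u (\<gamma> i))"
    by (intro sum_mono) auto
  also have "\<dots> = u (\<gamma> (Suc n)) - u (\<gamma> 0)"
    using sum_lessThan_telescope[of "\<lambda>i. u (\<gamma> i)" "Suc n"]
    by (simp add: lessThan_Suc_atMost atMost_atLeast0)
  also have "\<dots> = 0" by (simp add: \<gamma>_def)
  finally show "(\<Sum>i=0..n. xi1 ((g(Suc n := g 0)) (Suc i)) \<bullet> v i) \<le> (\<Sum>i=0..n. xi1 (g i) \<bullet> v i)"
    by (simp add: sum_subtractf \<gamma>_def)
qed

text \<open>Rockafellar's sums along horizontal chains from \<open>g\<close>, with the vector of
  each step taken at its starting point. A relation, because many chains join the same two
  points.\<close>

inductive chain_sum :: "(heis \<Rightarrow> layer1 set) \<Rightarrow> heis \<Rightarrow> heis \<Rightarrow> real \<Rightarrow> bool"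
  for T :: "heis \<Rightarrow> layer1 set" and g :: heis where
  refl: "chain_sum T g g 0"
| step: "chain_sum T g h s \<Longrightarrow> v \<in> T h \<Longrightarrow> chain_sum T g (h \<odot> hexp w) (s + v \<bullet> w)"

lemma chain_sum_trans:
  assumes "chain_sum T h k s'" "chain_sum T g h s"
  shows "chain_sum T g k (s + s')"
  using assms
proof induction
  case refl
  then show ?case by simp
next
  case (step k s' v w)
  then show ?case using chain_sum.step[of T g k "s + s'" v w] by (simp add: add.assoc)
qed

lemma chain_sum_sequence:
  assumes "chain_sum T g h s"
  shows "\<exists>n \<gamma> v. \<gamma> 0 = g \<and> \<gamma> n = h \<and> (\<forall>i<n. \<gamma> (Suc i) \<in> hplane (\<gamma> i) \<and> v i \<in> T (\<gamma> i)) \<and>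
    s = (\<Sum>i<n. v i \<bullet> (xi1 (\<gamma> (Suc i)) - xi1 (\<gamma> i)))"
  using assms
proof induction
  case refl
  show ?case by (rule exI[of _ 0]) auto
next
  case (step h s v w)
  then obtain n \<gamma> v' where IH: "\<gamma> 0 = g" "\<gamma> n = h"
    "\<forall>i<n. \<gamma> (Suc i) \<in> hplane (\<gamma> i) \<and> v' i \<in> T (\<gamma> i)"
    "s = (\<Sum>i<n. v' i \<bullet> (xi1 (\<gamma> (Suc i)) - xi1 (\<gamma> i)))"
    by blast
  show ?case
    by (rule exI[of _ "Suc n"], rule exI[of _ "\<gamma>(Suc n := h \<odot> hexp w)"], rule exI[of _ "v'(n := v)"])
      (use IH step.hyps in \<open>auto simp: less_Suc_eq hplane_iff\<close>)
qed

lemma chain_sum_loop_nonpos: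
  assumes cyc: "H_cyclically_monotone T" and "chain_sum T g g s"
  shows "s \<le> 0"
proof -
  obtain n \<gamma> v where \<gamma>: "\<gamma> 0 = g" "\<gamma> n = g"
    "\<And>i. i < n \<Longrightarrow> \<gamma> (Suc i) \<in> hplane (\<gamma> i)" "\<And>i. i < n \<Longrightarrow> v i \<in> T (\<gamma> i)"
    "s = (\<Sum>i<n. v i \<bullet> (xi1 (\<gamma> (Suc i)) - xi1 (\<gamma> i)))"
    using chain_sum_sequence[OF assms(2)] by blast
  \<comment> \<open>A loop of \<open>n\<close> steps is a closed H-sequence with last index
    \<open>n - 1\<close>, which must be positive. Loops with at most one step have sum 0.\<close>
  consider "n = 0" | "n = 1" | m where "n = Suc m" "0 < m"
    by (metis One_nat_def gr0_conv_Suc not_gr_zero)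
  then show ?thesis
  proof cases
    case 1
    then show ?thesis using \<gamma>(5) by simp
  next
    case 2
    then show ?thesis using \<gamma>(1,2,5) by simp
  next
    case 3
    have loop: "\<gamma> (Suc m) = \<gamma> 0" using \<gamma>(1,2) 3 by simp
    have "\<gamma> 0 \<in> hplane (\<gamma> m)" using \<gamma>(3)[of m] 3 loop by simp
    then have "closed_H_sequence m \<gamma>"
      unfolding closed_H_sequence_def using \<gamma>(3) 3 hplane_sym less_SucI by blast
    moreover have "\<forall>i\<le>m. (\<gamma> i, v i) \<in> sv_gph T"
      using \<gamma>(4) 3 by (fastforce simp: sv_gph_def sv_dom_def less_Suc_eq_le)
    ultimately have
      "(\<Sum>i=0..m. xi1 ((\<gamma>(Suc m := \<gamma> 0)) (Suc i)) \<bullet> v i) \<le> (\<Sum>i=0..m. xi1 (\<gamma> i) \<bullet> v i)"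
      using cyc unfolding H_cyclically_monotone_def by blast
    moreover have "\<gamma>(Suc m := \<gamma> 0) = \<gamma>" using loop by (metis fun_upd_triv)
    ultimately have "(\<Sum>i=0..m. xi1 (\<gamma> (Suc i)) \<bullet> v i) \<le> (\<Sum>i=0..m. xi1 (\<gamma> i) \<bullet> v i)"
      by (simp only:)
    then show ?thesis
      unfolding \<gamma>(5) 3 lessThan_Suc_atMost atMost_atLeast0
      by (simp only: inner_diff_right inner_commute sum_subtractf diff_le_0_iff_le)
  qed
qed

lemma chain_sum_exists:
  assumes ne: "\<And>g. T g \<noteq> {}"
  shows "\<exists>s. chain_sum T g h s"
proof -
  have step: "\<exists>s. chain_sum T g (k \<odot> hexp w) s" if "\<exists>s. chain_sum T g k s" for k w
    using that ne[of k] chain_sum.step by blast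
  obtain x y t x' y' t' where g: "g = (x, y, t)" and h: "h = (x', y', t')"
    by (cases g; cases h)
  \<comment> \<open>A quarter of the height of \<open>h\<close> above the plane through
    \<open>g\<close>: the rectangle with sides 1 and \<open>- c\<close> lifts by
    \<open>4 * c\<close>, after which \<open>h\<close> is one horizontal step away.\<close>
  define c where "c = (t' - t - 2 * (x' * y - x * y')) / 4"
  have "h = g \<odot> hexp (1, 0) \<odot> hexp (0, - c) \<odot> hexp (-1, 0) \<odot> hexp (0, c) \<odot> hexp (x' - x, y' - y)"
    by (simp add: g h c_def field_simps)
  then show ?thesis
    using step chain_sum.refl by metis
qed

text \<open>Appending a step adds \<open>v \<bullet> w\<close> to a sum, so the supremum of all sums
  obeys the subgradient inequality. A fixed chain back to the base point closes every chain to a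
  loop and so bounds the sums above.\<close>

lemma H_cyclically_monotone_potential:
  assumes cyc: "H_cyclically_monotone T" and ne: "\<And>g. T g \<noteq> {}"
  obtains u where "\<And>g. T g \<subseteq> H_subdiff u g"
proof
  define S where "S g = {s. chain_sum T (0, 0, 0) g s}" for g
  define u where "u g = Sup (S g)" for g
  have S_ne: "S g \<noteq> {}" for g using chain_sum_exists[OF ne] by (auto simp: S_def)
  have S_bdd: "bdd_above (S g)" for g
  proof -
    obtain c where c: "chain_sum T g (0, 0, 0) c"
      using chain_sum_exists[of T, OF ne] by blast
    have "s \<le> - c" if "s \<in> S g" for s
      using chain_sum_loop_nonpos[OF cyc chain_sum_trans[OF c]] that by (force simp: S_def)
    then show ?thesis by (rule bdd_aboveI)
  qed
  fix g
  show "T g \<subseteq> H_subdiff u g"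
  proof
    fix v assume v: "v \<in> T g"
    have "u g + v \<bullet> w \<le> u (g \<odot> hexp w)" for w
    proof -
      have "s + v \<bullet> w \<le> u (g \<odot> hexp w)" if "s \<in> S g" for s
        unfolding u_def using that v S_bdd by (intro cSup_upper) (auto simp: S_def intro: chain_sum.step)
      then have "u g \<le> u (g \<odot> hexp w) - v \<bullet> w"
        unfolding u_def[of g] using S_ne by (intro cSup_least) (auto simp: algebra_simps)
      then show ?thesis by simp
    qed
    then show "v \<in> H_subdiff u g" by (simp add: H_subdiff_def)
  qed
qed

section \<open>Surjectivity from maximality, and the converse\<close>

lemma maximal_H_cyclically_monotone_surjective:
  assumes lam: "lam > 0" and mono: "H_monotone T" and dom: "sv_dom T = UNIV"
    and max: "maximal_H_cyclically_monotone T"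
  shows "\<exists>g'\<in>hplane g. \<exists>v\<in>T g'. z = xi1 g' + lam *\<^sub>R v"
proof -
  have ne: "T g \<noteq> {}" for g using dom by (auto simp: sv_dom_def)
  obtain u where u: "\<And>g. T g \<subseteq> H_subdiff u g"
    using H_cyclically_monotone_potential max ne unfolding maximal_H_cyclically_monotone_def by metis
  then have T: "T = H_subdiff u"
    using max H_cyclically_monotone_subdiff[of u] unfolding maximal_H_cyclically_monotone_def
    by (metis ext psubsetI)
  have cont: "continuous_on UNIV u"
    using H_subdiff_continuous ne unfolding T by blast
  obtain v0 where v0: "v0 \<in> T g" using ne by blast
  define c where "c = xi1 g - z"
  \<comment> \<open>With \<open>g' = g \<odot> hexp w\<close>, this is
    \<open>xi1 g' + lam *\<^sub>R v - z\<close>, so a zero of \<open>F\<close> solves the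
    equation.\<close>
  define \<phi> where "\<phi> = (\<lambda>w v :: layer1. c + w + lam *\<^sub>R v)"
  define F where "F w = \<phi> w ` T (g \<odot> hexp w)" for w
  \<comment> \<open>Comparison with \<open>v0\<close> at the centre gives
    \<open>w \<bullet> y \<ge> r * r - r * norm (c + lam *\<^sub>R v0)\<close> on the sphere, which
    is nonnegative for this radius.\<close>
  define r where "r = norm (c + lam *\<^sub>R v0) + 1"
  have "\<exists>w\<in>cball 0 r. 0 \<in> F w"
  proof (rule set_valued_zero_exists)
    show "0 < r" by (simp add: r_def add_nonneg_pos)
    have "{(w, y). w \<in> cball 0 r \<and> y \<in> F w} =
        (\<lambda>q. (fst q, \<phi> (fst q) (snd q))) ` {(w, v). w \<in> cball 0 r \<and> v \<in> H_subdiff u (g \<odot> hexp w)}"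
      by (force simp: F_def T)
    moreover have "compact \<dots>"
      unfolding \<phi>_def
      by (intro compact_continuous_image compact_H_subdiff_graph cont continuous_intros)
    ultimately show "compact {(w, y). w \<in> cball 0 r \<and> y \<in> F w}" by simp
    show "convex (F w)" for w
    proof -
      have "F w = (+) (c + w) ` (*\<^sub>R) lam ` T (g \<odot> hexp w)"
        by (simp add: F_def \<phi>_def image_image)
      then show ?thesis
        unfolding T by (simp only:) (intro convex_translation convex_scaling convex_H_subdiff)
    qed
    show "F w \<noteq> {}" for w using ne by (simp add: F_def)
    show "0 \<le> w \<bullet> y" if w: "norm w = r" and y: "y \<in> F w" for w y
    proof -
      obtain v where v: "v \<in> T (g \<odot> hexp w)" "y = c + w + lam *\<^sub>R v"
        using y by (auto simp: F_def \<phi>_def)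
      have "g \<odot> hexp w \<in> sv_dom T \<inter> hplane g" using dom by (auto simp: hplane_iff)
      then have "0 \<le> (v - v0) \<bullet> (xi1 (g \<odot> hexp w) - xi1 g)"
        using mono v0 v(1) dom unfolding H_monotone_def by blast
      then have "0 \<le> lam * ((v - v0) \<bullet> w)" using lam by simp
      moreover have "w \<bullet> y = w \<bullet> (c + lam *\<^sub>R v0) + w \<bullet> w + lam * ((v - v0) \<bullet> w)"
        by (simp add: v(2) inner_simps inner_commute algebra_simps)
      moreover have "- (r * norm (c + lam *\<^sub>R v0)) \<le> w \<bullet> (c + lam *\<^sub>R v0)"
        using Cauchy_Schwarz_ineq2[of w "c + lam *\<^sub>R v0"] w by (simp add: abs_le_iff)
      moreover have "w \<bullet> w = r * r" using w by (simp add: dot_square_norm power2_eq_square)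
      moreover have "r * norm (c + lam *\<^sub>R v0) \<le> r * r"
        by (intro mult_left_mono) (simp_all add: r_def)
      ultimately show ?thesis by linarith
    qed
  qed
  then obtain w v where v: "v \<in> T (g \<odot> hexp w)" "c + w + lam *\<^sub>R v = 0"
    by (auto simp: F_def \<phi>_def)
  then have "z = xi1 (g \<odot> hexp w) + lam *\<^sub>R v"
    by (simp add: c_def algebra_simps)
  then show ?thesis using v(1) hplane_iff by blast
qed

text \<open>For a solution \<open>(g', v')\<close> of the equation met by \<open>(g, v)\<close>, the
  differences of base points and of vectors are proportional with factor \<open>- lam\<close>, so
  monotonicity of the extension forces both to vanish.\<close>

lemma surjective_imp_maximal_H_monotone:
  assumes lam: "lam > 0" and mono: "H_monotone T"
    and surj: "\<And>g z. \<exists>g'\<in>hplane g. \<exists>v\<in>T g'. z = xi1 g' + lam *\<^sub>R v"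
  shows "maximal_H_monotone T"
proof -
  have "v \<in> T g" if T': "H_monotone T'" "\<And>g. T g \<subseteq> T' g" and v: "v \<in> T' g" for T' g v
  proof -
    obtain g' v' where g': "g' \<in> hplane g" and v': "v' \<in> T g'"
      and eq: "xi1 g + lam *\<^sub>R v = xi1 g' + lam *\<^sub>R v'"
      using surj[of g "xi1 g + lam *\<^sub>R v"] by blast
    have d: "xi1 g' - xi1 g = - lam *\<^sub>R (v' - v)"
      using eq by (simp add: algebra_simps)
    have "v' \<in> T' g'" using T'(2) v' by blast
    then have "0 \<le> (v' - v) \<bullet> (xi1 g' - xi1 g)"
      using T'(1) v g' unfolding H_monotone_def sv_dom_def by blast
    then have "lam * (norm (v' - v))\<^sup>2 \<le> 0" unfolding d by (simp add: power2_norm_eq_inner)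
    then have "v' = v" using lam by (simp add: mult_le_0_iff)
    \<comment> \<open>Within a horizontal plane a point is determined by its image under
      \<open>xi1\<close>.\<close>
    moreover from this have "g' = g"
      using d g' hplane_iff_xi1[of g' g] by (simp add: hmult_hexp_eq_self_iff)
    ultimately show ?thesis using v' by simp
  qed
  then show ?thesis using mono unfolding maximal_H_monotone_def by blast
qed

theorem theorem1p1:
  fixes lam :: real and T :: "heis \<Rightarrow> layer1 set"
  assumes "lam > 0"
    and "H_monotone T"
    and "sv_dom T = UNIV"
  shows "(maximal_H_cyclically_monotone T \<longrightarrow>
           (\<forall>g. (\<Union>g' \<in> hplane g. {xi1 g' + lam *\<^sub>R v | v. v \<in> T g'}) = UNIV)) \<and>
         ((\<forall>g. (\<Union>g' \<in> hplane g. {xi1 g' + lam *\<^sub>R v | v. v \<in> T g'}) = UNIV) \<longrightarrow>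
           maximal_H_monotone T)"
proof -
  have "(\<Union>g' \<in> hplane g. {xi1 g' + lam *\<^sub>R v | v. v \<in> T g'}) = UNIV \<longleftrightarrow>
      (\<forall>z. \<exists>g'\<in>hplane g. \<exists>v\<in>T g'. z = xi1 g' + lam *\<^sub>R v)" for g
    unfolding set_eq_iff by blast
  then show ?thesis
    using maximal_H_cyclically_monotone_surjective[OF assms]
      surjective_imp_maximal_H_monotone[OF assms(1,2)]
    by simp
qed

end
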